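(* Let $n,k,d,\beta$ be positive integers with $k\le d<n$, let $\mathbb{F}_q$ be any finite field with $q\ge n$, and put $\alpha=d\beta$ and $B=\left(kd-\binom{k}{2}\right)\beta$. Then there exists a linear code over $\mathbb{F}_q$ storing a file of $B$ symbols over $\mathbb{F}_q$ across $n$ nodes, each storing $\alpha$ symbols over $\mathbb{F}_q$, such that: (i) the entire file can be recovered from the data stored in any $k$ of the $n$ nodes; (ii) the data stored in any node can be recovered from any $d$ other nodes with a download of exactly $\beta=\frac{B}{kd-\binom{k}{2}}$ symbols from each of the $d$ nodes; (iii) for any node $i\in\{1,\dots,n\}$ there exists at least one set of $d$ other nodes from which the data stored in node $i$ can be recovered with both the download from each of these $d$ nodes and the read at each of these $d$ nodes equal to $\beta=\frac{B}{kd-\binom{k}{2}}$ symbols (i.e., by repair-by-transfer).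
   Context: A linear code here is given by $\mathbb{F}_q$-linear encoding maps $f_i:\mathbb{F}_q^B\to\mathbb{F}_q^\alpha$, $i=1,\dots,n$; for file $F\in\mathbb{F}_q^B$, node $i$ stores $W_i=f_i(F)$. To recover the data of node $i$ from a set $\mathcal{D}$ of $d$ other nodes, each $j\in\mathcal{D}$ passes some symbols over $\mathbb{F}_q$ computed as a function of $W_j$ (the function may depend on $i,j,\mathcal{D}$ but not on the file), and $W_i$ must be determined by everything passed. The download from node $j$ is the number of symbols it passes. The read at node $j$ is the number of its $\alpha$ stored symbols that must be accessed in order to compute what it passes. Repair-by-transfer means that each helper node simply reads and passes some of its stored symbols without any computation. *)

theory Defs
  imports "Jordan_Normal_Form.Matrix" "HOL-Library.FuncSet"
begin

text \<open>Vectors over the field \<^typ>\<open>'a\<close> are those of \<open>Jordan_Normal_Form\<close>: \<^term>\<open>carrier_vec m\<close> is the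
  space of \<open>m\<close>-tuples, with coordinates indexed by \<open>0, \<dots>, m - 1\<close>. Nodes are numbered \<open>1, \<dots>, n\<close>.\<close>

definition linear_vec_map :: "nat \<Rightarrow> nat \<Rightarrow> ('a::field vec \<Rightarrow> 'a vec) \<Rightarrow> bool" where
  "linear_vec_map B \<alpha> h \<longleftrightarrow>
     h \<in> carrier_vec B \<rightarrow> carrier_vec \<alpha> \<and>
     (\<forall>x\<in>carrier_vec B. \<forall>y\<in>carrier_vec B. h (x + y) = h x + h y) \<and>
     (\<forall>c. \<forall>x\<in>carrier_vec B. h (c \<cdot>\<^sub>v x) = c \<cdot>\<^sub>v h x)"

definition linear_code :: "nat \<Rightarrow> nat \<Rightarrow> nat \<Rightarrow> (nat \<Rightarrow> 'a::field vec \<Rightarrow> 'a vec) \<Rightarrow> bool" where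
  "linear_code n B \<alpha> f \<longleftrightarrow> (\<forall>i\<in>{1..n}. linear_vec_map B \<alpha> (f i))"

definition file_recoverable :: "nat \<Rightarrow> (nat \<Rightarrow> 'a::field vec \<Rightarrow> 'a vec) \<Rightarrow> nat set \<Rightarrow> bool" where
  "file_recoverable B f K \<longleftrightarrow>
     (\<exists>dec. \<forall>F\<in>carrier_vec B. dec (\<lambda>j\<in>K. f j F) = F)"

text \<open>In a repair of node \<open>i\<close> by the set \<open>D\<close>, helper \<open>j\<close> passes the vector \<open>g j W\<^sub>j\<close> of \<open>\<gamma> j\<close> symbols;
  so \<open>\<gamma> j\<close> is the download from \<open>j\<close>. The functions \<open>g\<close> and \<open>rec\<close> do not depend on the file,
  and \<open>g\<close> need not be linear.\<close>

definition repairs ::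
  "nat \<Rightarrow> nat \<Rightarrow> (nat \<Rightarrow> 'a::field vec \<Rightarrow> 'a vec) \<Rightarrow> nat \<Rightarrow> nat set \<Rightarrow> (nat \<Rightarrow> nat) \<Rightarrow>
   (nat \<Rightarrow> 'a vec \<Rightarrow> 'a vec) \<Rightarrow> bool" where
  "repairs B \<alpha> f i D \<gamma> g \<longleftrightarrow>
     (\<forall>j\<in>D. g j \<in> carrier_vec \<alpha> \<rightarrow> carrier_vec (\<gamma> j)) \<and>
     (\<exists>rec. \<forall>F\<in>carrier_vec B. rec (\<lambda>j\<in>D. g j (f j F)) = f i F)"

text \<open>The set \<open>C\<close> consists of the contents a node can have, i.e. the image of its encoding map. The
  least number of stored symbols is taken over all sets of positions whose symbols
  determine what is passed, for every possible content of the node.\<close>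

definition computable_from_positions ::
  "'a vec set \<Rightarrow> ('a::field vec \<Rightarrow> 'a vec) \<Rightarrow> nat set \<Rightarrow> bool" where
  "computable_from_positions C h S \<longleftrightarrow> (\<exists>e. \<forall>w\<in>C. h w = e (\<lambda>s\<in>S. w $ s))"

definition node_read :: "nat \<Rightarrow> 'a vec set \<Rightarrow> ('a::field vec \<Rightarrow> 'a vec) \<Rightarrow> nat" where
  "node_read \<alpha> C h =
     (LEAST m. \<exists>S\<subseteq>{..<\<alpha>}. card S = m \<and> computable_from_positions C h S)"

definition by_transfer :: "nat \<Rightarrow> nat \<Rightarrow> ('a::field vec \<Rightarrow> 'a vec) \<Rightarrow> bool" where
  "by_transfer \<alpha> m h \<longleftrightarrow>
     (\<exists>p. p \<in> {..<m} \<rightarrow> {..<\<alpha>} \<and> inj_on p {..<m} \<and>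
          (\<forall>w\<in>carrier_vec \<alpha>. h w = vec m (\<lambda>l. w $ p l)))"

end

theory Submission
  imports Defs "HOL-Computational_Algebra.Polynomial"
begin

text \<open>
  Take the product-matrix code: the file fills the free entries of symmetric \<open>d \<times> d\<close> matrices
  \<open>M\<^sub>s\<close> (\<open>s < \<beta>\<close>) whose lower right \<open>(d - k) \<times> (d - k)\<close> block is zero, and node \<open>j\<close> has the
  Vandermonde vector \<open>\<psi>\<^sub>j = (1, x\<^sub>j, \<dots>, x\<^sub>j\<^sup>d\<^sup>-\<^sup>1)\<close> for distinct \<open>x\<^sub>j\<close>.
  Usually node \<open>j\<close> stores the row \<open>\<psi>\<^sub>j\<^sup>T M\<^sub>s\<close>. Here it stores the equivalent \<open>d\<close> symbols
  \<open>\<psi>\<^sub>j\<^sup>T M\<^sub>s \<psi>\<^sub>i\<close>, with \<open>i\<close> running over the \<open>d\<close> cyclic successors of \<open>j\<close>. Since helper \<open>j\<close> of node \<open>i\<close>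
  passes \<open>\<psi>\<^sub>j\<^sup>T M\<^sub>s \<psi>\<^sub>i\<close>, the \<open>d\<close> cyclic predecessors of \<open>i\<close> repair it without computation.
\<close>

section \<open>Polynomial interpolation and existence of decoders\<close>

text \<open>A nonzero polynomial of degree below \<open>m\<close> has fewer than \<open>m\<close>
  roots, but the points \<open>x j\<close> would be at least \<open>m\<close> distinct ones. This is
  the Vandermonde independence behind all decoding below.\<close>

lemma power_sum_eq_0_imp_coeff_0:
  fixes c :: "nat \<Rightarrow> 'a::idom"
  assumes "inj_on x J" and "finite J" and "m \<le> card J"
    and zero: "\<And>j. j \<in> J \<Longrightarrow> (\<Sum>a<m. c a * x j ^ a) = 0"
    and "a < m"
  shows "c a = 0"
proof -
  define p where "p = (\<Sum>a<m. monom (c a) a)"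
  have coeff_p: "coeff p b = (if b < m then c b else 0)" for b
    by (simp add: p_def coeff_sum if_distrib cong: if_cong)
  have "p = 0"
  proof (rule ccontr)
    assume "p \<noteq> 0"
    have "x ` J \<subseteq> {z. poly p z = 0}"
      using zero by (auto simp: p_def poly_sum poly_monom)
    with \<open>p \<noteq> 0\<close> have "card (x ` J) \<le> card {z. poly p z = 0}"
      by (intro card_mono poly_roots_finite)
    also have "\<dots> \<le> degree p"
      using \<open>p \<noteq> 0\<close> by (rule card_poly_roots_bound)
    also have "\<dots> < m"
    proof -
      have "lead_coeff p \<noteq> 0"
        using \<open>p \<noteq> 0\<close> by simp
      then show ?thesis
        by (metis coeff_p)
    qed
    finally show False
      using assms by (simp add: card_image)
  qed
  then show ?thesis
    using coeff_p[of a] \<open>a < m\<close> by simp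
qed

text \<open>Evaluating \<open>u\<close> at a chosen preimage under \<open>h\<close> does not depend
  on the choice. This turns statements about pairs of files into decoders and helper
  functions.\<close>

lemma factor_through_on:
  assumes "\<And>x y. x \<in> A \<Longrightarrow> y \<in> A \<Longrightarrow> h x = h y \<Longrightarrow> u x = u y"
  shows "\<exists>r. \<forall>x\<in>A. r (h x) = u x"
  using assms by (intro exI[of _ "\<lambda>z. u (inv_into A h z)"])
    (metis f_inv_into_f image_eqI inv_into_into)

section \<open>The read of a helper that only transfers symbols\<close>

text \<open>The \<open>m\<close> transferred positions suffice. Conversely, \<open>m'\<close>
  symbols take at most \<open>q^m'\<close> joint values over a field of size \<open>q\<close>, while
  \<open>h\<close> attains all \<open>q^m\<close> vectors on \<open>C\<close>; hence
  \<open>m\<close> \<le> \<open>m'\<close>.\<close>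

lemma node_read_by_transfer:
  fixes h :: "'a::{field,finite} vec \<Rightarrow> 'a vec"
  assumes h: "by_transfer \<alpha> m h" and C: "C \<subseteq> carrier_vec \<alpha>" and onto: "carrier_vec m \<subseteq> h ` C"
  shows "node_read \<alpha> C h = m"
  unfolding node_read_def
proof (rule Least_equality)
  obtain p where p: "p \<in> {..<m} \<rightarrow> {..<\<alpha>}" "inj_on p {..<m}"
    and hp: "\<forall>w\<in>carrier_vec \<alpha>. h w = vec m (\<lambda>l. w $ p l)"
    using h unfolding by_transfer_def by blast
  have "h w = vec m (\<lambda>l. (\<lambda>s\<in>p ` {..<m}. w $ s) (p l))" if "w \<in> C" for w
    using hp C that by (auto intro!: eq_vecI)
  then have "computable_from_positions C h (p ` {..<m})"
    unfolding computable_from_positions_def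
    by (intro exI[of _ "\<lambda>v. vec m (\<lambda>l. v (p l))"]) blast
  then show "\<exists>S\<subseteq>{..<\<alpha>}. card S = m \<and> computable_from_positions C h S"
    using p by (intro exI[of _ "p ` {..<m}"]) (auto simp: card_image)
next
  fix m' assume "\<exists>S\<subseteq>{..<\<alpha>}. card S = m' \<and> computable_from_positions C h S"
  then obtain S e where S: "S \<subseteq> {..<\<alpha>}" "card S = m'"
    and e: "\<forall>w\<in>C. h w = e (\<lambda>s\<in>S. w $ s)"
    unfolding computable_from_positions_def by blast
  have "finite S"
    using S finite_subset by blast
  let ?q = "card (UNIV :: 'a set)"
  have sub: "vec m ` ({..<m} \<rightarrow>\<^sub>E (UNIV :: 'a set)) \<subseteq> e ` (S \<rightarrow>\<^sub>E UNIV)"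
  proof
    fix v assume "v \<in> vec m ` ({..<m} \<rightarrow>\<^sub>E (UNIV :: 'a set))"
    then have "v \<in> h ` C"
      using onto by auto
    then obtain w where "w \<in> C" "v = h w"
      by blast
    then show "v \<in> e ` (S \<rightarrow>\<^sub>E UNIV)"
      using e by auto
  qed
  have inj: "inj_on (vec m) ({..<m} \<rightarrow>\<^sub>E (UNIV :: 'a set))"
  proof (rule inj_onI)
    fix u v :: "nat \<Rightarrow> 'a"
    assume uv: "u \<in> {..<m} \<rightarrow>\<^sub>E UNIV" "v \<in> {..<m} \<rightarrow>\<^sub>E UNIV" "vec m u = vec m v"
    then have "u l = v l" if "l < m" for l
      using that by (metis index_vec)
    then show "u = v"
      using uv by (intro PiE_ext[of u "{..<m}" "\<lambda>_. UNIV" v]) auto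
  qed
  have "?q ^ m = card (vec m ` ({..<m} \<rightarrow>\<^sub>E (UNIV :: 'a set)))"
    using card_image[OF inj] by (simp add: card_PiE)
  also have "\<dots> \<le> card (e ` (S \<rightarrow>\<^sub>E UNIV))"
    using sub \<open>finite S\<close> by (intro card_mono finite_imageI finite_PiE) auto
  also have "\<dots> \<le> card (S \<rightarrow>\<^sub>E (UNIV :: 'a set))"
    using \<open>finite S\<close> by (intro card_image_le finite_PiE) auto
  also have "\<dots> = ?q ^ m'"
    using S \<open>finite S\<close> by (simp add: card_PiE)
  finally have "?q ^ m \<le> ?q ^ m'" .
  moreover have "card {0, 1 :: 'a} \<le> ?q"
    by (intro card_mono) auto
  then have "1 < ?q"
    by simp
  ultimately show "m \<le> m'"
    by (meson power_le_imp_le_exp)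
qed

section \<open>Counting the free matrix entries\<close>

text \<open>Row \<open>a\<close> contributes \<open>d - a\<close> entries on or to the right of the
  diagonal. These are the free entries of one symmetric matrix with vanishing lower right
  block.\<close>

lemma card_upper_triangle:
  fixes k d :: nat
  assumes "k \<le> d"
  shows "card (SIGMA a:{..<k}. {a..<d}) = k * d - (k choose 2)"
proof -
  have "(\<Sum>a<k. d - a) + (k choose 2) = k * d"
    using assms
  proof (induction k)
    case (Suc k)
    then show ?case
      by (simp add: numeral_2_eq_2)
  qed (simp add: numeral_2_eq_2)
  then show ?thesis
    by simp
qed

section \<open>Cyclic order on the nodes\<close>

text \<open>The nodes are \<open>1, \<dots>, n\<close>, hence the shift by one after the reduction.\<close>

definition cyclic_successor :: "nat \<Rightarrow> nat \<Rightarrow> nat \<Rightarrow> nat" where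
  "cyclic_successor n j t = (j + t) mod n + 1"

text \<open>Solving \<open>(j + t) mod n + 1 = i\<close> gives \<open>j - 1\<close> congruent to
  \<open>i - t - 2\<close> modulo \<open>n\<close>; the summand \<open>2 * n\<close> keeps the
  natural subtraction from truncating for \<open>t < n\<close>.\<close>

definition cyclic_predecessor :: "nat \<Rightarrow> nat \<Rightarrow> nat \<Rightarrow> nat" where
  "cyclic_predecessor n i t = (i + 2 * n - t - 2) mod n + 1"

lemma inj_on_cyclic_successor: "inj_on (cyclic_successor n j) {..<n}"
proof (rule linorder_inj_onI)
  fix t t' assume "t < t'" "t \<in> {..<n}" "t' \<in> {..<n}"
  then show "cyclic_successor n j t \<noteq> cyclic_successor n j t'"
    using mod_eq_dvd_iff_nat[of "j + t" "j + t'" n]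
    by (auto simp: cyclic_successor_def dest: dvd_imp_le)
qed auto

lemma cyclic_successor_mem: "0 < n \<Longrightarrow> cyclic_successor n j t \<in> {1..n}"
  by (simp add: cyclic_successor_def Suc_leI)

lemma cyclic_predecessor_mem: "0 < n \<Longrightarrow> cyclic_predecessor n j t \<in> {1..n}"
  by (simp add: cyclic_predecessor_def Suc_leI)

lemma cyclic_successor_neq:
  assumes "j \<in> {1..n}" and "t + 1 < n"
  shows "cyclic_successor n j t \<noteq> j"
proof
  assume "cyclic_successor n j t = j"
  then have "(j + t) mod n = (j - 1) mod n"
    using assms by (auto simp: cyclic_successor_def)
  then have "n dvd t + 1"
    using assms mod_eq_dvd_iff_nat[of "j - 1" "j + t" n] by (auto simp: algebra_simps)
  then show False
    using assms by (auto dest: dvd_imp_le)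
qed

lemma cyclic_successor_predecessor:
  assumes "i \<in> {1..n}" and "t + 1 < n"
  shows "cyclic_successor n (cyclic_predecessor n i t) t = i"
proof -
  have "((i + 2 * n - t - 2) mod n + 1 + t) mod n = ((i + 2 * n - t - 2) + (1 + t)) mod n"
    by (simp add: mod_simps add.assoc del: add_Suc add_Suc_right)
  also have "(i + 2 * n - t - 2) + (1 + t) = (i - 1) + n * 2"
    using assms by auto
  also have "((i - 1) + n * 2) mod n = i - 1"
    using assms by (subst mod_mult_self2) auto
  finally show ?thesis
    using assms by (simp add: cyclic_successor_def cyclic_predecessor_def)
qed

section \<open>The code and its linearity\<close>

text \<open>The bijection \<open>pos\<close> is any numbering of the free entries
  \<open>(a, b)\<close> of the matrices \<open>s < \<beta>\<close> by file coordinates; it forces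
  \<open>B\<close> to be their number.\<close>

locale product_matrix_code =
  fixes n k d \<beta> :: nat and x :: "nat \<Rightarrow> 'a::{field,finite}"
    and pos :: "(nat \<times> nat) \<times> nat \<Rightarrow> nat" and B :: nat
  assumes k_pos: "0 < k" and \<beta>_pos: "0 < \<beta>" and k_le_d: "k \<le> d" and d_less_n: "d < n"
    and inj_x: "inj_on x {1..n}"
    and bij_pos: "bij_betw pos ((SIGMA a:{..<k}. {a..<d}) \<times> {..<\<beta>}) {..<B}"
begin

text \<open>Sorting the indices makes the matrix symmetric by construction, and
  \<open>min a b < k\<close> fails exactly on the zero block.\<close>

definition M :: "'a vec \<Rightarrow> nat \<Rightarrow> nat \<Rightarrow> nat \<Rightarrow> 'a" where
  "M F s a b = (if min a b < k then F $ pos ((min a b, max a b), s) else 0)"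

definition pairing :: "nat \<Rightarrow> nat \<Rightarrow> nat \<Rightarrow> 'a vec \<Rightarrow> 'a" where
  "pairing j i s F = (\<Sum>a<d. \<Sum>b<d. x j ^ a * M F s a b * x i ^ b)"

text \<open>Position \<open>t * \<beta> + s\<close> belongs to the \<open>t\<close>-th successor and
  matrix \<open>s\<close>, so the symbols meant for one node form a block of length \<beta>.\<close>

definition encode :: "nat \<Rightarrow> 'a vec \<Rightarrow> 'a vec" where
  "encode j F = vec (d * \<beta>) (\<lambda>p. pairing j (cyclic_successor n j (p div \<beta>)) (p mod \<beta>) F)"

definition helper_data :: "nat \<Rightarrow> nat \<Rightarrow> 'a vec \<Rightarrow> 'a vec" where
  "helper_data i j F = vec \<beta> (\<lambda>s. pairing j i s F)"

lemma M_sym: "M F s a b = M F s b a"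
  by (simp add: M_def min.commute max.commute)

lemma pos_less: "a \<le> b \<Longrightarrow> a < k \<Longrightarrow> b < d \<Longrightarrow> s < \<beta> \<Longrightarrow> pos ((a, b), s) < B"
  using bij_pos by (force simp: bij_betw_def)

lemma M_add:
  assumes "F \<in> carrier_vec B" "G \<in> carrier_vec B" "s < \<beta>" "a < d" "b < d"
  shows "M (F + G) s a b = M F s a b + M G s a b"
  using assms pos_less[of "min a b" "max a b" s] by (auto simp: M_def)

lemma M_smult:
  assumes "F \<in> carrier_vec B" "s < \<beta>" "a < d" "b < d"
  shows "M (c \<cdot>\<^sub>v F) s a b = c * M F s a b"
  using assms pos_less[of "min a b" "max a b" s] by (auto simp: M_def)

lemma pairing_add:
  "F \<in> carrier_vec B \<Longrightarrow> G \<in> carrier_vec B \<Longrightarrow> s < \<beta> \<Longrightarrow>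
    pairing j i s (F + G) = pairing j i s F + pairing j i s G"
  by (simp add: pairing_def M_add algebra_simps flip: sum.distrib)

lemma pairing_smult:
  "F \<in> carrier_vec B \<Longrightarrow> s < \<beta> \<Longrightarrow> pairing j i s (c \<cdot>\<^sub>v F) = c * pairing j i s F"
  by (simp add: pairing_def M_smult algebra_simps sum_distrib_left)

lemma encode_in_carrier [simp]: "encode j F \<in> carrier_vec (d * \<beta>)"
  by (simp add: encode_def)

lemma linear_code_encode: "linear_code n B (d * \<beta>) encode"
  using \<beta>_pos
  by (auto simp: linear_code_def linear_vec_map_def encode_def pairing_add pairing_smult
      intro!: eq_vecI)

lemma encode_nth:
  assumes "t < d" "s < \<beta>"
  shows "encode j F $ (t * \<beta> + s) = pairing j (cyclic_successor n j t) s F"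
proof -
  have "t * \<beta> + s < (t + 1) * \<beta>"
    using assms by simp
  also have "\<dots> \<le> d * \<beta>"
    using assms by (intro mult_le_mono1) simp
  finally show ?thesis
    using assms by (simp add: encode_def)
qed

section \<open>From pairings to rows, and from rows to the file\<close>

lemma coeff_0_of_power_sum:
  assumes "J \<subseteq> {1..n}" and "m \<le> card J"
    and "\<And>j. j \<in> J \<Longrightarrow> (\<Sum>a<m. c a * x j ^ a) = 0" and "a < m"
  shows "c a = 0"
proof (rule power_sum_eq_0_imp_coeff_0[where J = J and x = x and m = m])
  show "inj_on x J"
    using inj_x assms(1) by (rule inj_on_subset)
  show "finite J"
    using assms(1) finite_subset by blast
qed (use assms in auto)

text \<open>Agreement of the rows \<open>\<psi>\<^sub>j\<^sup>T M\<^sub>s\<close>: the content of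
  node \<open>j\<close> freed from the particular \<open>d\<close> evaluation points used to store
  it.\<close>

definition same_row :: "nat \<Rightarrow> 'a vec \<Rightarrow> 'a vec \<Rightarrow> bool" where
  "same_row j F G \<longleftrightarrow>
     (\<forall>s<\<beta>. \<forall>b<d. (\<Sum>a<d. x j ^ a * M F s a b) = (\<Sum>a<d. x j ^ a * M G s a b))"

lemma pairing_eq_row: "pairing j i s F = (\<Sum>b<d. (\<Sum>a<d. x j ^ a * M F s a b) * x i ^ b)"
  unfolding pairing_def by (subst sum.swap) (simp add: sum_distrib_right)

lemma pairing_commute: "pairing j i s F = pairing i j s F"
  unfolding pairing_def by (subst sum.swap) (simp add: M_sym mult_ac)

lemma same_row_imp_pairing_eq: "same_row j F G \<Longrightarrow> s < \<beta> \<Longrightarrow> pairing j i s F = pairing j i s G"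
  by (simp add: same_row_def pairing_eq_row)

lemma same_row_imp_encode_eq: "same_row j F G \<Longrightarrow> encode j F = encode j G"
  using \<beta>_pos by (auto simp: encode_def same_row_imp_pairing_eq intro!: eq_vecI)

text \<open>The difference of the two rows is the coefficient list of a polynomial of degree below
  \<open>d\<close> vanishing at \<open>d\<close> or more points. The set \<open>J\<close> will be
  the successors of \<open>j\<close> when reading a node, and the helpers when repairing it.\<close>

lemma pairings_eq_imp_same_row:
  assumes "J \<subseteq> {1..n}" and "d \<le> card J"
    and eq: "\<And>i s. i \<in> J \<Longrightarrow> s < \<beta> \<Longrightarrow> pairing j i s F = pairing j i s G"
  shows "same_row j F G"
  unfolding same_row_def
proof (intro allI impI)
  fix s b assume "s < \<beta>" "b < d"
  define c where "c b = (\<Sum>a<d. x j ^ a * M F s a b) - (\<Sum>a<d. x j ^ a * M G s a b)" for b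
  have "(\<Sum>b<d. c b * x i ^ b) = 0" if "i \<in> J" for i
    using eq[OF that \<open>s < \<beta>\<close>] by (simp add: c_def pairing_eq_row left_diff_distrib sum_subtractf)
  then have "c b = 0"
    using coeff_0_of_power_sum assms(1,2) \<open>b < d\<close> by blast
  then show "(\<Sum>a<d. x j ^ a * M F s a b) = (\<Sum>a<d. x j ^ a * M G s a b)"
    by (simp add: c_def)
qed

lemma encode_eq_imp_same_row:
  assumes "encode j F = encode j G"
  shows "same_row j F G"
proof (rule pairings_eq_imp_same_row)
  show "cyclic_successor n j ` {..<d} \<subseteq> {1..n}"
    using d_less_n cyclic_successor_mem by (metis gr_zeroI image_subsetI not_less0)
  have "inj_on (cyclic_successor n j) {..<d}"
    using inj_on_cyclic_successor by (rule inj_on_subset) (use d_less_n in auto)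
  then show "d \<le> card (cyclic_successor n j ` {..<d})"
    by (simp add: card_image)
next
  fix i s assume "i \<in> cyclic_successor n j ` {..<d}" "s < \<beta>"
  then obtain t where "t < d" "i = cyclic_successor n j t"
    by auto
  then show "pairing j i s F = pairing j i s G"
    using encode_nth[of t s j F] encode_nth[of t s j G] assms \<open>s < \<beta>\<close> by simp
qed

text \<open>Decoding takes two rounds. In a column \<open>b\<close> \<ge> \<open>k\<close> the rows
  from \<open>k\<close> on lie in the zero block, so \<open>k\<close> evaluations settle the other
  rows. Symmetry then gives the lower left block, after which \<open>k\<close> evaluations settle
  the remaining columns too.\<close>

lemma same_rows_imp_M_eq:
  assumes K: "K \<subseteq> {1..n}" "card K = k" and rows: "\<And>j. j \<in> K \<Longrightarrow> same_row j F G"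
    and "s < \<beta>" "a < d" "b < d"
  shows "M F s a b = M G s a b"
proof -
  define \<Delta> where "\<Delta> a b = M F s a b - M G s a b" for a b
  have sym: "\<Delta> a b = \<Delta> b a" for a b
    by (simp add: \<Delta>_def M_sym)
  \<comment> \<open>Once its lower entries vanish, a column of the difference is a polynomial of
    degree below \<open>k\<close> with the \<open>k\<close> roots \<open>x j\<close>,
    \<open>j\<close> in \<open>K\<close>.\<close>
  have column_0: "\<Delta> a b = 0"
    if lower: "\<And>a. a < d \<Longrightarrow> k \<le> a \<Longrightarrow> \<Delta> a b = 0" and ab: "a < k" "b < d" for a b
  proof (rule coeff_0_of_power_sum[where J = K and m = k and c = "\<lambda>a. \<Delta> a b"])
    fix j assume "j \<in> K"
    have "(\<Sum>a<k. \<Delta> a b * x j ^ a) = (\<Sum>a<d. \<Delta> a b * x j ^ a)"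
      using k_le_d lower by (intro sum.mono_neutral_left) auto
    also have "\<dots> = (\<Sum>a<d. x j ^ a * M F s a b) - (\<Sum>a<d. x j ^ a * M G s a b)"
      by (simp add: \<Delta>_def algebra_simps sum_subtractf)
    also have "\<dots> = 0"
      using rows[OF \<open>j \<in> K\<close>] \<open>s < \<beta>\<close> \<open>b < d\<close> by (simp add: same_row_def)
    finally show "(\<Sum>a<k. \<Delta> a b * x j ^ a) = 0" .
  qed (use K ab in auto)
  have right: "\<Delta> a b = 0" if "k \<le> b" "b < d" "a < d" for a b
  proof (cases "a < k")
    case True
    have "\<Delta> a' b = 0" if "k \<le> a'" for a'
      using that \<open>k \<le> b\<close> by (simp add: \<Delta>_def M_def)
    then show ?thesis
      using True \<open>b < d\<close> by (rule column_0)
  qed (use that in \<open>simp add: \<Delta>_def M_def\<close>)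
  have "\<Delta> a b = 0"
  proof (cases "a < k")
    case True
    \<comment> \<open>The lower part of this column is, by symmetry, part of a column already
      treated.\<close>
    have "\<Delta> a' b = 0" if "a' < d" "k \<le> a'" for a'
      using right[of a' b] sym[of a' b] that \<open>b < d\<close> by simp
    then show ?thesis
      using True \<open>b < d\<close> by (rule column_0)
  next
    case False
    then show ?thesis
      using right[of a b] sym[of a b] \<open>a < d\<close> \<open>b < d\<close> by simp
  qed
  then show ?thesis
    by (simp add: \<Delta>_def)
qed

lemma M_eq_imp_eq:
  assumes FG: "F \<in> carrier_vec B" "G \<in> carrier_vec B"
    and eq: "\<And>s a b. s < \<beta> \<Longrightarrow> a < d \<Longrightarrow> b < d \<Longrightarrow> M F s a b = M G s a b"
  shows "F = G"
proof (rule eq_vecI)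
  fix p assume "p < dim_vec G"
  then have "p \<in> pos ` ((SIGMA a:{..<k}. {a..<d}) \<times> {..<\<beta>})"
    using bij_pos FG by (simp add: bij_betw_def)
  then obtain a b s where "p = pos ((a, b), s)" "a < k" "a \<le> b" "b < d" "s < \<beta>"
    by auto
  then show "F $ p = G $ p"
    using eq[of s a b] k_le_d by (simp add: M_def min_def max_def split: if_splits)
qed (use FG in auto)

section \<open>File recovery and repair from arbitrary helpers\<close>

lemma file_recoverable_encode:
  assumes "K \<subseteq> {1..n}" "card K = k"
  shows "file_recoverable B encode K"
  unfolding file_recoverable_def
proof (rule factor_through_on)
  fix F G assume FG: "F \<in> carrier_vec B" "G \<in> carrier_vec B"
    and eq: "(\<lambda>j\<in>K. encode j F) = (\<lambda>j\<in>K. encode j G)"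
  have "same_row j F G" if "j \<in> K" for j
    using fun_cong[OF eq, of j] that by (simp add: encode_eq_imp_same_row)
  then show "F = G"
    by (rule M_eq_imp_eq[OF FG same_rows_imp_M_eq[OF assms]])
qed

text \<open>By symmetry of the matrices, what \<open>j\<close> sends is the row of node
  \<open>i\<close> evaluated at \<open>x j\<close>, and \<open>d\<close> such values fix the row.
  Only the values of \<open>g\<close> on actual contents matter for this, so both kinds of repair
  are covered.\<close>

lemma repairs_encode:
  assumes "D \<subseteq> {1..n}" "card D = d"
    and carrier: "\<And>j. j \<in> D \<Longrightarrow> g j \<in> carrier_vec (d * \<beta>) \<rightarrow> carrier_vec \<beta>"
    and g: "\<And>j F. j \<in> D \<Longrightarrow> F \<in> carrier_vec B \<Longrightarrow> g j (encode j F) = helper_data i j F"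
  shows "repairs B (d * \<beta>) encode i D (\<lambda>j. \<beta>) g"
  unfolding repairs_def
proof (intro conjI)
  show "\<forall>j\<in>D. g j \<in> carrier_vec (d * \<beta>) \<rightarrow> carrier_vec \<beta>"
    by (intro ballI carrier)
next
  show "\<exists>rec. \<forall>F\<in>carrier_vec B. rec (\<lambda>j\<in>D. g j (encode j F)) = encode i F"
  proof (rule factor_through_on)
    fix F G assume FG: "F \<in> carrier_vec B" "G \<in> carrier_vec B"
      and eq: "(\<lambda>j\<in>D. g j (encode j F)) = (\<lambda>j\<in>D. g j (encode j G))"
    have "pairing i j s F = pairing i j s G" if "j \<in> D" "s < \<beta>" for j s
    proof -
      have "helper_data i j F = helper_data i j G"
        using fun_cong[OF eq, of j] that FG by (simp add: g)
      then have "pairing j i s F = pairing j i s G"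
        using that unfolding helper_data_def by (metis index_vec)
      then show ?thesis
        by (simp add: pairing_commute)
    qed
    then show "encode i F = encode i G"
      using assms(1,2) by (intro same_row_imp_encode_eq pairings_eq_imp_same_row) auto
  qed
qed

text \<open>The content of node \<open>j\<close> determines its rows, hence its pairing with every
  node, including nodes that are not among its \<open>d\<close> successors.\<close>

lemma ex_helper_function:
  "\<exists>g. g \<in> carrier_vec (d * \<beta>) \<rightarrow> carrier_vec \<beta> \<and>
       (\<forall>F\<in>carrier_vec B. g (encode j F) = helper_data i j F)"
proof -
  have "\<exists>r. \<forall>F\<in>carrier_vec B. r (encode j F) = helper_data i j F"
  proof (rule factor_through_on)
    fix F G assume "encode j F = encode j G"
    then have "same_row j F G"
      by (rule encode_eq_imp_same_row)
    then show "helper_data i j F = helper_data i j G"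
      by (auto simp: helper_data_def same_row_imp_pairing_eq)
  qed
  then obtain r where r: "\<forall>F\<in>carrier_vec B. r (encode j F) = helper_data i j F"
    by blast
  show ?thesis
    \<comment> \<open>The function \<open>r\<close> is unspecified off the code; rebuilding its
      value as a vector of length \<beta> puts it in the right space everywhere.\<close>
    using r by (intro exI[of _ "\<lambda>w. vec \<beta> (\<lambda>s. r w $ s)"]) (auto simp: helper_data_def)
qed

lemma ex_repairs_encode:
  assumes "D \<subseteq> {1..n}" "card D = d"
  shows "\<exists>g. repairs B (d * \<beta>) encode i D (\<lambda>j. \<beta>) g"
proof -
  from choice[OF allI[OF ex_helper_function[of _ i]]]
  obtain g where "\<forall>j. g j \<in> carrier_vec (d * \<beta>) \<rightarrow> carrier_vec \<beta> \<and>
      (\<forall>F\<in>carrier_vec B. g j (encode j F) = helper_data i j F)" ..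
  then show ?thesis
    by (intro exI[of _ g] repairs_encode[OF assms]) simp_all
qed

section \<open>Repair-by-transfer\<close>

text \<open>Since \<open>\<psi>\<^sub>j\<close> starts with \<open>1\<close>, files that vanish outside the entries \<open>(0, 0)\<close> suffice.\<close>

lemma helper_data_onto: "carrier_vec \<beta> \<subseteq> helper_data i j ` carrier_vec B"
proof
  fix y :: "'a vec" assume y: "y \<in> carrier_vec \<beta>"
  let ?P = "(SIGMA a:{..<k}. {a..<d}) \<times> {..<\<beta>}"
  define F where "F = vec B (\<lambda>p. case inv_into ?P pos p of (ab, s) \<Rightarrow>
    if ab = (0, 0) then y $ s else 0)"
  have F_pos: "F $ pos ((a, b), s) = (if a = 0 \<and> b = 0 then y $ s else 0)"
    if "a \<le> b" "a < k" "b < d" "s < \<beta>" for a b s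
  proof -
    have "inv_into ?P pos (pos ((a, b), s)) = ((a, b), s)"
      using bij_pos that by (intro inv_into_f_f) (auto simp: bij_betw_def)
    then show ?thesis
      using pos_less[OF that] by (simp add: F_def)
  qed
  have M_F: "M F s a b = (if a = 0 then if b = 0 then y $ s else 0 else 0)"
    if "s < \<beta>" "a < d" "b < d" for s a b
    using that F_pos[of "min a b" "max a b" s] k_pos by (auto simp: M_def min_def max_def)
  have "pairing j i s F = y $ s" if "s < \<beta>" for s
  proof -
    have "pairing j i s F = (\<Sum>a<d. \<Sum>b<d. if b = 0 then if a = 0 then y $ s else 0 else 0)"
      unfolding pairing_def using that by (intro sum.cong refl) (auto simp: M_F)
    also have "\<dots> = y $ s"
      using k_pos k_le_d by (simp add: sum.delta)
    finally show ?thesis .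
  qed
  then have "helper_data i j F = y"
    using y by (auto simp: helper_data_def intro!: eq_vecI)
  moreover have "F \<in> carrier_vec B"
    by (simp add: F_def)
  ultimately show "y \<in> helper_data i j ` carrier_vec B"
    by blast
qed

text \<open>Each of the \<open>d\<close> cyclic predecessors of \<open>i\<close> has
  \<open>i\<close> among its first \<open>d\<close> successors, so it already stores its helper data
  for \<open>i\<close> as one block.\<close>

lemma ex_repair_by_transfer:
  assumes i: "i \<in> {1..n}"
  shows "\<exists>D. D \<subseteq> {1..n} - {i} \<and> card D = d \<and>
    (\<exists>g. repairs B (d * \<beta>) encode i D (\<lambda>j. \<beta>) g \<and>
      (\<forall>j\<in>D. by_transfer (d * \<beta>) \<beta> (g j) \<and>
        node_read (d * \<beta>) (encode j ` carrier_vec B) (g j) = \<beta>))"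
proof -
  define D where "D = cyclic_predecessor n i ` {..<d}"
  have succ_pred: "cyclic_successor n (cyclic_predecessor n i t) t = i" if "t < d" for t
    using cyclic_successor_predecessor[OF i] that d_less_n by simp
  have D_sub: "D \<subseteq> {1..n} - {i}"
  proof
    fix j assume "j \<in> D"
    then obtain t where t: "t < d" "j = cyclic_predecessor n i t"
      by (auto simp: D_def)
    then have "j \<in> {1..n}"
      using d_less_n cyclic_predecessor_mem by simp
    then show "j \<in> {1..n} - {i}"
      using t succ_pred cyclic_successor_neq[of j n t] d_less_n by auto
  qed
  \<comment> \<open>If two offsets led to the same predecessor, \<open>i\<close> would be its
    successor at both offsets.\<close>
  have "inj_on (cyclic_predecessor n i) {..<d}"
  proof (rule inj_onI)
    fix t t' assume "t \<in> {..<d}" "t' \<in> {..<d}"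
      and "cyclic_predecessor n i t = cyclic_predecessor n i t'"
    then show "t = t'"
      using succ_pred[of t] succ_pred[of t'] d_less_n
        inj_onD[OF inj_on_cyclic_successor[of n "cyclic_predecessor n i t"], of t t']
      by auto
  qed
  then have card_D: "card D = d"
    by (simp add: D_def card_image)
  have "\<forall>j\<in>D. \<exists>t<d. cyclic_successor n j t = i"
    using succ_pred by (auto simp: D_def)
  then obtain \<tau> where \<tau>: "\<And>j. j \<in> D \<Longrightarrow> \<tau> j < d" "\<And>j. j \<in> D \<Longrightarrow> cyclic_successor n j (\<tau> j) = i"
    by metis
  define g where "g j w = vec \<beta> (\<lambda>s. w $ (\<tau> j * \<beta> + s))" for j and w :: "'a vec"
  have g_encode: "g j (encode j F) = helper_data i j F" if "j \<in> D" for j F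
    using \<tau>[OF that] by (auto simp: g_def helper_data_def encode_nth intro!: eq_vecI)
  have "g j \<in> carrier_vec (d * \<beta>) \<rightarrow> carrier_vec \<beta>" for j
    by (simp add: g_def)
  moreover have "D \<subseteq> {1..n}"
    using D_sub by blast
  ultimately have "repairs B (d * \<beta>) encode i D (\<lambda>j. \<beta>) g"
    using card_D g_encode by (intro repairs_encode)
  moreover have transfer: "by_transfer (d * \<beta>) \<beta> (g j)" if "j \<in> D" for j
  proof -
    have "\<tau> j * \<beta> + s < d * \<beta>" if "s < \<beta>" for s
    proof -
      have "\<tau> j * \<beta> + s < (\<tau> j + 1) * \<beta>"
        using that by simp
      also have "\<dots> \<le> d * \<beta>"
        using \<tau>(1)[OF \<open>j \<in> D\<close>] by (intro mult_le_mono1) simp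
      finally show ?thesis .
    qed
    then show ?thesis
      unfolding by_transfer_def
      by (intro exI[of _ "\<lambda>s. \<tau> j * \<beta> + s"]) (auto simp: g_def inj_on_def)
  qed
  moreover have "node_read (d * \<beta>) (encode j ` carrier_vec B) (g j) = \<beta>" if "j \<in> D" for j
  proof (rule node_read_by_transfer[OF transfer[OF that]])
    \<comment> \<open>Surjectivity onto all vectors of length \<beta> excludes a read below
      \<beta>.\<close>
    show "carrier_vec \<beta> \<subseteq> g j ` encode j ` carrier_vec B"
      using helper_data_onto by (simp add: image_image g_encode[OF that])
  qed auto
  ultimately show ?thesis
    using D_sub card_D by (intro exI[of _ D] exI[of _ g] conjI ballI)
qed

end

section \<open>Choosing evaluation points and a numbering of the entries\<close>

theorem mainTheorem3:
  fixes n k d \<beta> \<alpha> B :: nat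
  assumes "0 < n" and "0 < k" and "0 < d" and "0 < \<beta>"
    and "k \<le> d" and "d < n"
    and "card (UNIV :: 'a::{field,finite} set) \<ge> n"
    and "\<alpha> = d * \<beta>"
    and "B = (k * d - (k choose 2)) * \<beta>"
  shows "\<exists>f :: nat \<Rightarrow> 'a vec \<Rightarrow> 'a vec.
    linear_code n B \<alpha> f \<and>
    (\<forall>K. K \<subseteq> {1..n} \<and> card K = k \<longrightarrow> file_recoverable B f K) \<and>
    (\<forall>i\<in>{1..n}. \<forall>D. D \<subseteq> {1..n} - {i} \<and> card D = d \<longrightarrow>
       (\<exists>g. repairs B \<alpha> f i D (\<lambda>j. \<beta>) g)) \<and>
    (\<forall>i\<in>{1..n}. \<exists>D. D \<subseteq> {1..n} - {i} \<and> card D = d \<and>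
       (\<exists>g. repairs B \<alpha> f i D (\<lambda>j. \<beta>) g \<and>
            (\<forall>j\<in>D. by_transfer \<alpha> \<beta> (g j) \<and>
                   node_read \<alpha> (f j ` carrier_vec B) (g j) = \<beta>)))"
proof -
  have "card {1..n} \<le> card (UNIV :: 'a set)"
    using assms by simp
  then obtain x :: "nat \<Rightarrow> 'a" where x: "inj_on x {1..n}"
    using card_le_inj[of "{1..n}" "UNIV :: 'a set"] by auto
  let ?P = "(SIGMA a:{..<k}. {a..<d}) \<times> {..<\<beta>}"
  have "card ?P = card {..<B}"
    using card_upper_triangle[OF \<open>k \<le> d\<close>] assms(9)
    by (simp add: card_cartesian_product del: card_SigmaI)
  then obtain pos where "bij_betw pos ?P {..<B}"
    using finite_same_card_bij[of ?P "{..<B}"] by auto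
  then interpret product_matrix_code n k d \<beta> x pos B
    using assms x by unfold_locales auto
  show ?thesis
    unfolding \<open>\<alpha> = d * \<beta>\<close>
    using linear_code_encode file_recoverable_encode ex_repairs_encode ex_repair_by_transfer
    by (intro exI[of _ encode]) (simp add: subset_Diff_insert)
qed

end
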